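(* Let $h_1,h_2,\alpha_1,\lambda\in\mathbb{C}$ and $t_1,t_2\in\mathbb{C}\setminus\{0\}$. Consider the $q$-difference equation (variant of the biconfluent $q$-hypergeometric equation, type $(0,2)$) $$g(qx)+q^{2\lambda+1}(1-q^{-h_1-1/2}t_1^{-1}x)(1-q^{-h_2-1/2}t_2^{-1}x)g(x/q)$$ $$-\big[q^{\alpha_1+2\lambda-h_1-h_2}t_1^{-1}t_2^{-1}x^2-q^{\lambda+1/2}(q^{-h_1}t_1^{-1}+q^{-h_2}t_2^{-1})x+q^\lambda(q+1)\big]g(x)=0.$$ (i) The function $$x^{-\alpha_1}\sum_{n=0}^\infty(q^{-\lambda-\alpha_1+1/2}x^{-1})^n(q^{\lambda+\alpha_1};q)_n\sum_{\ell=0}^n\frac{q^{-\ell(n-\ell)}(q^{h_1}t_1)^{n-\ell}(q^{h_2}t_2)^\ell}{(q;q)_{n-\ell}(q;q)_\ell}$$ is a formal solution of this equation. (ii) Let $(i,i')=(1,2)$ or $(2,1)$. Then $$x^{-\alpha_1}\sum_{n=0}^\infty\Big(\frac{q^{h_i+1/2}t_i}{x};q\Big)_n(q^{\lambda+\alpha_1};q)_nq^n\sum_{k=0}^n\frac{q^{k^2}(q^{\lambda+\alpha_1+h_i-h_{i'}}t_i/t_{i'})^k}{(q;q)_k(q;q)_{n-k}}$$ is a formal solution of this equation. (iii) Let $(i,i')=(1,2)$ or $(2,1)$. Then $$g(x)=x^\lambda\sum_{n=0}^\infty\Big(\frac{q^{h_i+1/2}t_i}{x};q\Big)_n\frac{(q^{\lambda+\alpha_1};q)_n}{(q;q)_n}\Big(\frac{x}{q^{h_{i'}-1/2}t_{i'}}\Big)^n\Big(=x^\lambda\,{}_2\phi_1\Big(q^{\lambda+\alpha_1},\frac{q^{h_i+1/2}t_i}{x};0;q,\frac{x}{q^{h_{i'}-1/2}t_{i'}}\Big)\Big)$$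 is a formal solution of this equation.
   Context: Conventions: $q\in\mathbb{C}\setminus\{0\}$ is not a root of unity, with a fixed choice of $\log q$, and $q^{a}=\exp(a\log q)$. $(\lambda;q)_n=\prod_{j=0}^{n-1}(1-\lambda q^j)$. The basic hypergeometric series is ${}_r\phi_s(a_1,\dots,a_r;b_1,\dots,b_s;q,z)=\sum_{n\ge0}\frac{(a_1;q)_n\cdots(a_r;q)_n}{(b_1;q)_n\cdots(b_s;q)_n(q;q)_n}\big[(-1)^nq^{n(n-1)/2}\big]^{1+s-r}z^n$. Formal solutions: convergence is not considered. For $\mu\in\mathbb{C}$, $x^\mu$ is a symbol with $(q^{\pm1}x)^\mu=q^{\pm\mu}x^\mu$. Each series has the form $x^\mu\sum_{n\ge0}a_n\varphi_n(x)$, where $a_n$ does not depend on $x$ and $\varphi_n$ (the $x$-dependent part of the $n$-th term) is a polynomial of degree $n$ in $x$ or a polynomial of degree $n$ in $1/x$ (here $\varphi_n=x^{-n}$ in (i), $(q^{h_i+1/2}t_i/x;q)_n$ in (ii), $(q^{h_i+1/2}t_i/x;q)_n\,x^n$ in (iii)). It is a formal solution if, substituting termwise into the left-hand side, dividing by $x^\mu$ (and also by $x^2$ when the $\varphi_n$ are polynomials in $1/x$), and expanding each resulting term in the basis $(\varphi_m)_{m\ge0}$ (in the $1/x$ case, the basis of polynomials in $1/x$), the total coefficient of every $\varphi_m$ (a finite sum) is zero. If the series terminates this means it is an exact solution. *)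

theory Defs
  imports Complex_Main "HOL-Computational_Algebra.Polynomial"
begin

text \<open>Powers of \<open>q\<close> with complex exponent, relative to a chosen logarithm \<open>L\<close> of \<open>q\<close>.\<close>

definition q_pow :: "complex \<Rightarrow> complex \<Rightarrow> complex" where
  "q_pow L a = exp (a * L)"

definition q_poch :: "complex \<Rightarrow> complex \<Rightarrow> nat \<Rightarrow> complex" where
  "q_poch a q n = (\<Prod>j<n. 1 - a * q ^ j)"

text \<open>The \<open>n\<close>-th term of the basic hypergeometric series with numerator parameters \<open>as\<close> and
  denominator parameters \<open>bs\<close>. Convergence plays no role, so the series is handled
  through its terms.\<close>

definition q_hyper_term ::
    "complex list \<Rightarrow> complex list \<Rightarrow> complex \<Rightarrow> complex \<Rightarrow> nat \<Rightarrow> complex" where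
  "q_hyper_term as bs q z n =
     (\<Prod>a\<leftarrow>as. q_poch a q n) / ((\<Prod>b\<leftarrow>bs. q_poch b q n) * q_poch q q n)
       * ((-1) ^ n * q ^ (n * (n - 1) div 2)) powi (1 + int (length bs) - int (length as))
       * z ^ n"

text \<open>Left-hand side of the equation at \<open>x\<close>; the last three arguments are the values
  \<open>g(qx)\<close>, \<open>g(x/q)\<close> and \<open>g(x)\<close>. Only \<open>h 1\<close>, \<open>h 2\<close>, \<open>t 1\<close>, \<open>t 2\<close> are used.\<close>

definition variant_lhs ::
    "complex \<Rightarrow> complex \<Rightarrow> (nat \<Rightarrow> complex) \<Rightarrow> (nat \<Rightarrow> complex) \<Rightarrow> complex \<Rightarrow> complex
       \<Rightarrow> complex \<Rightarrow> complex \<Rightarrow> complex \<Rightarrow> complex \<Rightarrow> complex" where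
  "variant_lhs q L h t \<alpha> lam x gqx gxq gx =
     gqx
     + q_pow L (2 * lam + 1)
         * (1 - q_pow L (- h 1 - 1/2) * inverse (t 1) * x)
         * (1 - q_pow L (- h 2 - 1/2) * inverse (t 2) * x) * gxq
     - (q_pow L (\<alpha> + 2 * lam - h 1 - h 2) * inverse (t 1) * inverse (t 2) * x\<^sup>2
        - q_pow L (lam + 1/2)
            * (q_pow L (- h 1) * inverse (t 1) + q_pow L (- h 2) * inverse (t 2)) * x
        + q_pow L lam * (q + 1)) * gx"

text \<open>A symbolic expression \<open>x\<^sup>\<mu> f(x)\<close> is represented by \<open>\<mu>\<close> and \<open>f\<close>; as \<open>x\<^sup>\<mu>\<close> is only a symbol
  with \<open>(q x)\<^sup>\<mu> = q\<^sup>\<mu> x\<^sup>\<mu>\<close> and \<open>(x/q)\<^sup>\<mu> = q\<^sup>-\<^sup>\<mu> x\<^sup>\<mu>\<close>, it is not \<open>x powr \<mu>\<close>. For an equation whose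
  left-hand side \<open>E\<close> is linear in the three values of \<open>g\<close>, the following is the result of
  substituting \<open>x\<^sup>\<mu> f(x)\<close> for \<open>g(x)\<close> and dividing by \<open>x\<^sup>\<mu>\<close>.\<close>

definition subst_lhs ::
    "complex \<Rightarrow> complex \<Rightarrow> (complex \<Rightarrow> complex \<Rightarrow> complex \<Rightarrow> complex \<Rightarrow> complex)
       \<Rightarrow> complex \<Rightarrow> (complex \<Rightarrow> complex) \<Rightarrow> complex \<Rightarrow> complex" where
  "subst_lhs q L E \<mu> f x =
     E x (q_pow L \<mu> * f (q * x)) (q_pow L (- \<mu>) * f (x / q)) (f x)"

definition basis_x :: "(nat \<Rightarrow> complex \<Rightarrow> complex) \<Rightarrow> bool" where
  "basis_x \<phi> \<longleftrightarrow>
     (\<forall>n. \<exists>p. p \<noteq> 0 \<and> degree p = n \<and> (\<forall>x. x \<noteq> 0 \<longrightarrow> \<phi> n x = poly p x))"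

definition basis_inverse_x :: "(nat \<Rightarrow> complex \<Rightarrow> complex) \<Rightarrow> bool" where
  "basis_inverse_x \<phi> \<longleftrightarrow>
     (\<forall>n. \<exists>p. p \<noteq> 0 \<and> degree p = n \<and> (\<forall>x. x \<noteq> 0 \<longrightarrow> \<phi> n x = poly p (1 / x)))"

text \<open>\<open>v n\<close> is the result of substituting the \<open>n\<close>-th term, and \<open>d n m\<close> is the coefficient of
  \<open>\<phi> m\<close> in its expansion, which is unique when \<open>\<phi>\<close> is one of the above bases.\<close>

definition coefficients_cancel ::
    "(nat \<Rightarrow> complex \<Rightarrow> complex) \<Rightarrow> (nat \<Rightarrow> complex \<Rightarrow> complex) \<Rightarrow> bool" where
  "coefficients_cancel \<phi> v \<longleftrightarrow>
     (\<exists>d :: nat \<Rightarrow> nat \<Rightarrow> complex.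
        (\<forall>n. finite {m. d n m \<noteq> 0}
             \<and> (\<forall>x. x \<noteq> 0 \<longrightarrow> v n x = (\<Sum>m | d n m \<noteq> 0. d n m * \<phi> m x)))
      \<and> (\<forall>m. finite {n. d n m \<noteq> 0} \<and> (\<Sum>n | d n m \<noteq> 0. d n m) = 0))"

text \<open>\<open>x\<^sup>\<mu> \<Sum>\<^sub>n u n x\<close> is a formal solution of \<open>E = 0\<close>, where \<open>\<phi> n\<close> is the \<open>x\<close>-dependent part of
  the term \<open>u n\<close>.\<close>

definition formal_solution ::
    "complex \<Rightarrow> complex \<Rightarrow> (complex \<Rightarrow> complex \<Rightarrow> complex \<Rightarrow> complex \<Rightarrow> complex)
       \<Rightarrow> complex \<Rightarrow> (nat \<Rightarrow> complex \<Rightarrow> complex) \<Rightarrow> (nat \<Rightarrow> complex \<Rightarrow> complex) \<Rightarrow> bool" where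
  "formal_solution q L E \<mu> \<phi> u \<longleftrightarrow>
     (\<exists>a. \<forall>n x. x \<noteq> 0 \<longrightarrow> u n x = a n * \<phi> n x)
     \<and> (basis_x \<phi> \<and> coefficients_cancel \<phi> (\<lambda>n. subst_lhs q L E \<mu> (u n))
        \<or> basis_inverse_x \<phi> \<and> coefficients_cancel \<phi> (\<lambda>n x. subst_lhs q L E \<mu> (u n) x / x\<^sup>2))"

end

theory Submission
  imports Defs
begin

text \<open>Write \<open>A = q\<^sup>h\<^sup>1 t\<^sub>1\<close>, \<open>B = q\<^sup>h\<^sup>2 t\<^sub>2\<close> (or the other way round: the equation is symmetric) and
  \<open>c = q\<^sup>\<lambda>\<^sup>+\<^sup>\<alpha>\<close>. In each of the three bases the operator sends \<open>\<phi>\<^sub>n\<close> to a combination of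
  \<open>\<phi>\<^sub>n\<^sub>-\<^sub>1, \<dots>, \<phi>\<^sub>n\<^sub>+\<^sub>2\<close>, so a formal solution is a solution of a recurrence of order at most three.
  For (i) it has order two and, once the factor \<open>(c; q)\<^sub>n\<close> is removed, is that of the Rogers--Szego
  polynomials in base \<open>1/q\<close>. For (ii) it is a combination of two consecutive instances of the
  three-term recurrence of the Stieltjes--Wigert polynomials at \<open>- c A / B\<close>. For (iii) the image of
  every term is a telescoping combination of the numbers \<open>a\<^sub>n (1 - q\<^sup>n)\<close>.\<close>

section \<open>Pochhammer symbols and complex powers of q\<close>

lemma q_poch_0 [simp]: "q_poch a q 0 = 1"
  by (simp add: q_poch_def)

lemma q_poch_Suc: "q_poch a q (Suc n) = q_poch a q n * (1 - a * q ^ n)"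
  by (simp add: q_poch_def)

text \<open>Splits off the first factor instead of the last one, which links the symbol at a to the
  symbol at the dilated argument q a.\<close>

lemma q_poch_Suc_shift: "q_poch a q (Suc n) = (1 - a) * q_poch (a * q) q n"
  unfolding q_poch_def by (subst prod.lessThan_Suc_shift) (simp add: mult.assoc)

lemma q_poch_of_zero [simp]: "q_poch 0 q n = 1"
  by (simp add: q_poch_def)

lemma q_pow_add: "q_pow L (a + b) = q_pow L a * q_pow L b"
  by (simp add: q_pow_def distrib_right exp_add)

lemma q_pow_minus: "q_pow L (- a) = inverse (q_pow L a)"
  by (simp add: q_pow_def exp_minus)

lemma q_pow_diff: "q_pow L (a - b) = q_pow L a / q_pow L b"
  by (simp add: q_pow_def left_diff_distrib exp_diff)

lemma q_pow_nonzero [simp]: "q_pow L a \<noteq> 0"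
  by (simp add: q_pow_def)

lemma q_pow_half: "q_pow L (1/2) * q_pow L (1/2) = exp L"
  by (simp add: q_pow_def flip: exp_add)

section \<open>The three polynomial bases\<close>

lemma basis_inverse_x_power: "basis_inverse_x (\<lambda>n x. inverse x ^ n)"
  unfolding basis_inverse_x_def
proof
  fix n
  show "\<exists>p. p \<noteq> 0 \<and> degree p = n \<and> (\<forall>x::complex. x \<noteq> 0 \<longrightarrow> inverse x ^ n = poly p (1 / x))"
    by (intro exI[of _ "monom 1 n"]) (simp add: degree_monom_eq poly_monom inverse_eq_divide)
qed

lemma degree_prod_linear:
  fixes f g :: "nat \<Rightarrow> complex"
  assumes "\<And>j. g j \<noteq> 0"
  shows "(\<Prod>j<n. [:f j, g j:]) \<noteq> 0 \<and> degree (\<Prod>j<n. [:f j, g j:]) = n"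
proof -
  have "degree (\<Prod>j<n. [:f j, g j:]) = (\<Sum>j<n. degree [:f j, g j:])"
    using assms by (intro degree_prod_eq_sum_degree) auto
  then show ?thesis
    using assms by (simp add: prod_zero_iff)
qed

text \<open>In y = 1/x the symbol is the product of the factors 1 - K q^j y. Since K and q are
  nonzero, each factor has degree exactly one.\<close>

lemma basis_inverse_x_q_poch:
  assumes "K \<noteq> 0" "q \<noteq> 0"
  shows "basis_inverse_x (\<lambda>n x. q_poch (K / x) q n)"
  unfolding basis_inverse_x_def
proof
  fix n
  show "\<exists>p. p \<noteq> 0 \<and> degree p = n \<and> (\<forall>x. x \<noteq> 0 \<longrightarrow> q_poch (K / x) q n = poly p (1 / x))"
    using degree_prod_linear[of "\<lambda>j. - K * q ^ j" "\<lambda>_. 1" n] assms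
    by (intro exI[of _ "\<Prod>j<n. [:1, - K * q ^ j:]"])
      (auto simp: degree_prod_linear poly_prod q_poch_def intro!: prod.cong)
qed

text \<open>Each of the n factors of the symbol absorbs one x, so the product becomes a monic
  polynomial with roots K q^j.\<close>

lemma q_poch_times_power:
  assumes "x \<noteq> 0"
  shows "q_poch (K / x) q n * x ^ n = (\<Prod>j<n. x - K * q ^ j)"
proof -
  have "q_poch (K / x) q n * x ^ n = (\<Prod>j<n. (1 - K / x * q ^ j) * x)"
    by (simp add: q_poch_def prod.distrib)
  also have "\<dots> = (\<Prod>j<n. x - K * q ^ j)"
    using assms by (intro prod.cong) (auto simp: field_simps)
  finally show ?thesis .
qed

lemma basis_x_q_poch: "basis_x (\<lambda>n x. q_poch (K / x) q n * x ^ n)"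
  unfolding basis_x_def
proof
  fix n
  show "\<exists>p. p \<noteq> 0 \<and> degree p = n \<and> (\<forall>x. x \<noteq> 0 \<longrightarrow> q_poch (K / x) q n * x ^ n = poly p x)"
    using degree_prod_linear[of "\<lambda>_. 1" "\<lambda>j. - K * q ^ j" n]
    by (intro exI[of _ "\<Prod>j<n. [:- K * q ^ j, 1:]"])
      (auto simp: q_poch_times_power poly_prod intro!: prod.cong)
qed

section \<open>From banded expansions to a recurrence\<close>

text \<open>The coefficient of \<phi>_m collects contributions from the terms m + 1, m, m - 1 and m
  - 2 only. The relations for m = 0 and m = 1 are stated separately because some of these indices
  are negative there. The condition at index 0 is needed since \<open>0 - 1\<close> is 0 for natural
  numbers.\<close>

lemma coefficients_cancel_band:
  fixes e\<^sub>0 e\<^sub>1 e\<^sub>2 e\<^sub>3 :: "nat \<Rightarrow> complex"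
  assumes v: "\<And>n x. x \<noteq> 0 \<Longrightarrow>
      v n x = e\<^sub>0 n * \<phi> (n - 1) x + e\<^sub>1 n * \<phi> n x + e\<^sub>2 n * \<phi> (Suc n) x + e\<^sub>3 n * \<phi> (Suc (Suc n)) x"
    and "e\<^sub>0 0 = 0"
    and r0: "e\<^sub>0 1 + e\<^sub>1 0 = 0"
    and r1: "e\<^sub>0 2 + e\<^sub>1 1 + e\<^sub>2 0 = 0"
    and r2: "\<And>m. e\<^sub>0 (Suc (Suc (Suc m))) + e\<^sub>1 (Suc (Suc m)) + e\<^sub>2 (Suc m) + e\<^sub>3 m = 0"
  shows "coefficients_cancel \<phi> v"
proof -
  \<comment> \<open>Testing \<open>Suc m = n\<close> rather than \<open>m = n - 1\<close> leaves row
    0 without a lower entry, so that the lower entry never collides with the diagonal.\<close>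
  define d where "d n m =
    (if Suc m = n then e\<^sub>0 n else if m = n then e\<^sub>1 n else if m = Suc n then e\<^sub>2 n
     else if m = Suc (Suc n) then e\<^sub>3 n else 0)" for n m
  have row: "{m. d n m \<noteq> 0} \<subseteq> {n - 1..Suc (Suc n)}" for n
    by (auto simp: d_def split: if_splits)
  have col: "{n. d n m \<noteq> 0} \<subseteq> {m - 2..Suc m}" for m
    by (auto simp: d_def split: if_splits)
  have "v n x = (\<Sum>m | d n m \<noteq> 0. d n m * \<phi> m x)" if "x \<noteq> 0" for n x
  proof -
    have "(\<Sum>m | d n m \<noteq> 0. d n m * \<phi> m x) = (\<Sum>m = n - 1..Suc (Suc n). d n m * \<phi> m x)"
      using row by (intro sum.mono_neutral_left) auto
    also have "\<dots> = v n x"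
    proof (cases n)
      case 0
      then show ?thesis
        using assms(2) that by (simp add: v d_def)
    next
      case (Suc k)
      have "{n - 1..Suc (Suc n)} = {k, Suc k, Suc (Suc k), Suc (Suc (Suc k))}"
        using Suc by auto
      then show ?thesis
        using Suc that by (simp add: v d_def)
    qed
    finally show ?thesis by simp
  qed
  moreover have "(\<Sum>n | d n m \<noteq> 0. d n m) = 0" for m
  proof -
    have "(\<Sum>n | d n m \<noteq> 0. d n m) = (\<Sum>n = m - 2..Suc m. d n m)"
      using col by (intro sum.mono_neutral_left) auto
    also have "\<dots> = 0"
    proof -
      consider "m = 0" | "m = 1" | k where "m = Suc (Suc k)"
        by (metis One_nat_def not0_implies_Suc)
      then show ?thesis
      proof cases
        case 1
        then show ?thesis using r0 by (simp add: d_def add.commute)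
      next
        case 2
        then show ?thesis using r1 by (simp add: d_def numeral_2_eq_2 add_ac)
      next
        case 3
        then have "{m - 2..Suc m} = {k, Suc k, Suc (Suc k), Suc (Suc (Suc k))}"
          by auto
        then show ?thesis
          using 3 r2[of k] by (simp add: d_def add_ac)
      qed
    qed
    finally show ?thesis .
  qed
  moreover have "finite {m. d n m \<noteq> 0}" "finite {m. d m n \<noteq> 0}" for n
    by (rule finite_subset[OF row] finite_subset[OF col], simp)+
  ultimately show ?thesis
    unfolding coefficients_cancel_def by blast
qed

section \<open>Recurrences of the Rogers--Szego and Stieltjes--Wigert polynomials\<close>

locale nonroot =
  fixes q :: complex
  assumes q_nonzero [simp]: "q \<noteq> 0"
    and nonroot: "\<And>n::nat. n > 0 \<Longrightarrow> q ^ n \<noteq> 1"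
begin

text \<open>The denominators 1 - q^n with n > 0, in the shapes they take once powers of successors
  are unfolded.\<close>

lemma q_power_neq_1 [simp]: "q \<noteq> 1" "q * q ^ n \<noteq> 1" "q * (q * q ^ n) \<noteq> 1"
  using nonroot[of 1] nonroot[of "Suc n"] nonroot[of "Suc (Suc n)"] by auto

lemma q_poch_q_Suc: "q_poch q q (Suc n) = q_poch q q n * (1 - q * q ^ n)"
  by (simp add: q_poch_Suc)

lemma q_poch_q_nonzero [simp]: "q_poch q q n \<noteq> 0"
  by (induction n) (simp_all add: q_poch_q_Suc)

text \<open>Homogeneous Rogers--Szego polynomial in base \<open>1/q\<close>, divided by \<open>(q; q)\<^sub>n\<close>.\<close>

definition rogers_szego :: "complex \<Rightarrow> complex \<Rightarrow> nat \<Rightarrow> complex" where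
  "rogers_szego a b n =
     (\<Sum>l\<le>n. q powi (- int (l * (n - l))) * a ^ (n - l) * b ^ l / (q_poch q q (n - l) * q_poch q q l))"

lemma rogers_szego_0 [simp]: "rogers_szego a b 0 = 1"
  by (simp add: rogers_szego_def)

lemma rogers_szego_1: "(1 - q) * rogers_szego a b 1 = a + b"
  by (simp add: rogers_szego_def q_poch_Suc divide_simps)

text \<open>Multiplied by (q; q)_{m+1}, this is the classical recurrence H_{n+1} = (a + b) H_n - (1
  - p^n) a b H_{n-1} with p = 1/q and n = m + 1. It is checked summand by summand.\<close>

lemma rogers_szego_rec:
  "(1 - q ^ Suc (Suc m)) * rogers_szego a b (Suc (Suc m)) =
     (a + b) * rogers_szego a b (Suc m) + a * b / q ^ Suc m * rogers_szego a b m"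
proof -
  define T where "T n l = a ^ (n - l) * b ^ l / (q ^ (l * (n - l)) * (q_poch q q (n - l) * q_poch q q l))" for n l
  have S: "rogers_szego a b n = (\<Sum>l\<le>n. T n l)" for n
    by (simp add: rogers_szego_def T_def power_int_minus divide_simps del: of_nat_mult)
  \<comment> \<open>At the two ends of the top sum only one of the three sums on the right
    contributes: the one with factor a at l = 0, the one with factor b at l = m + 2.\<close>
  have left: "(1 - q ^ Suc (Suc m)) * T (Suc (Suc m)) 0 = a * T (Suc m) 0"
    by (simp add: T_def q_poch_q_Suc divide_simps)
  have right: "(1 - q ^ Suc (Suc m)) * T (Suc (Suc m)) (Suc (Suc m)) = b * T (Suc m) (Suc m)"
    by (simp add: T_def q_poch_q_Suc divide_simps)
  have mid: "(1 - q ^ Suc (Suc m)) * T (Suc (Suc m)) (Suc j) =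
      a * T (Suc m) (Suc j) + b * T (Suc m) j + a * b / q ^ Suc m * T m j" if "j \<le> m" for j
  proof -
    from that obtain i where m: "m = j + i" using le_Suc_ex by blast
    \<comment> \<open>With Q = q^(j+1) and R = q^(i+1) the three summands on the right are C times Q
      (1 - R), R (1 - Q) and (1 - Q)(1 - R). These multipliers add up to 1 - Q R, and Q R =
      q^(m+2).\<close>
    define C where "C = T (Suc (Suc m)) (Suc j)"
    have 1: "a * T (Suc m) (Suc j) = q * q ^ j * (1 - q * q ^ i) * C"
      by (simp add: C_def m T_def Suc_diff_le q_poch_q_Suc power_add mult_ac)
    have 2: "b * T (Suc m) j = q * q ^ i * (1 - q * q ^ j) * C"
      by (simp add: C_def m T_def Suc_diff_le q_poch_q_Suc power_add mult_ac)
    have 3: "a * b / q ^ Suc m * T m j = (1 - q * q ^ i) * (1 - q * q ^ j) * C"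
      by (simp add: C_def m T_def Suc_diff_le q_poch_q_Suc power_add mult_ac)
    show ?thesis
      unfolding 1 2 3 C_def[symmetric] by (simp add: m power_add algebra_simps)
  qed
  have "(1 - q ^ Suc (Suc m)) * rogers_szego a b (Suc (Suc m))
      = (1 - q ^ Suc (Suc m)) * T (Suc (Suc m)) 0
        + (\<Sum>j\<le>m. (1 - q ^ Suc (Suc m)) * T (Suc (Suc m)) (Suc j))
        + (1 - q ^ Suc (Suc m)) * T (Suc (Suc m)) (Suc (Suc m))"
    unfolding S by (subst sum.atMost_Suc_shift)
      (simp add: distrib_left sum_distrib_left add_ac del: power_Suc)
  also have "\<dots> = a * (T (Suc m) 0 + (\<Sum>j\<le>m. T (Suc m) (Suc j)))
      + b * ((\<Sum>j\<le>m. T (Suc m) j) + T (Suc m) (Suc m)) + a * b / q ^ Suc m * (\<Sum>j\<le>m. T m j)"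
    unfolding left right using mid
    by (simp add: sum.distrib sum_distrib_left distrib_left add_ac del: power_Suc)
  also have "T (Suc m) 0 + (\<Sum>j\<le>m. T (Suc m) (Suc j)) = rogers_szego a b (Suc m)"
    unfolding S by (subst sum.atMost_Suc_shift) simp
  also have "(\<Sum>j\<le>m. T (Suc m) j) + T (Suc m) (Suc m) = rogers_szego a b (Suc m)"
    unfolding S by simp
  finally show ?thesis
    unfolding S by (simp add: distrib_right)
qed

text \<open>The usual argument is \<open>- w\<close>.\<close>

definition stieltjes_wigert :: "complex \<Rightarrow> nat \<Rightarrow> complex" where
  "stieltjes_wigert w n = (\<Sum>k\<le>n. q ^ (k\<^sup>2) * w ^ k / (q_poch q q k * q_poch q q (n - k)))"

lemma stieltjes_wigert_0 [simp]: "stieltjes_wigert w 0 = 1"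
  by (simp add: stieltjes_wigert_def)

lemma stieltjes_wigert_1: "(1 - q) * stieltjes_wigert w 1 = 1 + q * w"
  by (simp add: stieltjes_wigert_def q_poch_Suc divide_simps)

text \<open>Again the identity holds summand by summand: index k in degree m + 2 is matched with
  index k - 1 in degree m + 1 (the part with factor w) and with index k in degrees m + 1 and
  m.\<close>

lemma stieltjes_wigert_rec:
  "(1 - q ^ Suc (Suc m)) * stieltjes_wigert w (Suc (Suc m)) =
     (w * q ^ Suc m * q ^ Suc (Suc m) + 1 + q - q ^ Suc (Suc m)) * stieltjes_wigert w (Suc m)
     - q * stieltjes_wigert w m"
proof -
  \<comment> \<open>Padding with zeros lets sums of three different degrees run over one index
    range.\<close>
  define T where "T n k = (if k \<le> n then q ^ (k\<^sup>2) * w ^ k / (q_poch q q k * q_poch q q (n - k)) else 0)" for n k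
  have S: "stieltjes_wigert w n = (\<Sum>k\<le>N. T n k)" if "n \<le> N" for n N
    unfolding stieltjes_wigert_def T_def using that
    by (intro sum.mono_neutral_cong_left) auto
  have zero: "(1 - q ^ Suc (Suc m)) * T (Suc (Suc m)) 0 =
      (1 + q - q ^ Suc (Suc m)) * T (Suc m) 0 - q * T m 0"
    by (simp add: T_def q_poch_q_Suc divide_simps) (simp add: algebra_simps)
  have step: "(1 - q ^ Suc (Suc m)) * T (Suc (Suc m)) (Suc j) =
      w * q ^ Suc m * q ^ Suc (Suc m) * T (Suc m) j
      + ((1 + q - q ^ Suc (Suc m)) * T (Suc m) (Suc j) - q * T m (Suc j))" if j: "j \<le> Suc m" for j
  proof -
    \<comment> \<open>At j = m + 1 both summands of index j + 1 on the right vanish, at j = m only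
      the one in degree m does. Otherwise no summand vanishes through the padding.\<close>
    consider "j = Suc m" | "j = m" | i where "m = Suc j + i"
      using j by (metis le_Suc_eq less_iff_Suc_add nat_less_le add_Suc)
    then show ?thesis
    proof cases
      case 1
      then show ?thesis
        by (simp add: T_def q_poch_q_Suc power2_eq_square power_add power_mult divide_simps;
          simp add: algebra_simps)
    next
      case 2
      then show ?thesis
        by (simp add: T_def q_poch_q_Suc power2_eq_square power_add power_mult divide_simps;
          simp add: algebra_simps)
    next
      case 3
      then show ?thesis
        by (simp add: T_def Suc_diff_le q_poch_q_Suc power2_eq_square power_add power_mult divide_simps;
          simp add: algebra_simps)
    qed
  qed
  have "(1 - q ^ Suc (Suc m)) * stieltjes_wigert w (Suc (Suc m))
      = (1 - q ^ Suc (Suc m)) * T (Suc (Suc m)) 0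
        + (\<Sum>j\<le>Suc m. (1 - q ^ Suc (Suc m)) * T (Suc (Suc m)) (Suc j))"
    unfolding S[OF order_refl] by (subst sum.atMost_Suc_shift)
      (simp add: distrib_left sum_distrib_left add_ac del: power_Suc)
  also have "\<dots> = w * q ^ Suc m * q ^ Suc (Suc m) * (\<Sum>j\<le>Suc m. T (Suc m) j)
     + ((1 + q - q ^ Suc (Suc m)) * (T (Suc m) 0 + (\<Sum>j\<le>Suc m. T (Suc m) (Suc j)))
     - q * (T m 0 + (\<Sum>j\<le>Suc m. T m (Suc j))))"
    unfolding zero using step
    by (simp add: sum.distrib sum_subtractf sum_distrib_left distrib_left del: power_Suc sum.atMost_Suc)
  also have "\<dots> = w * q ^ Suc m * q ^ Suc (Suc m) * stieltjes_wigert w (Suc m)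
     + ((1 + q - q ^ Suc (Suc m)) * stieltjes_wigert w (Suc m) - q * stieltjes_wigert w m)"
    unfolding sum.atMost_Suc_shift[symmetric]
    using S[of m "Suc (Suc m)"] S[of "Suc m" "Suc (Suc m)"] S[of "Suc m" "Suc m"] by simp
  finally show ?thesis
    by (simp add: algebra_simps)
qed

end

text \<open>The four-term recurrence for \<open>(c; q)\<^sub>n q\<^sup>n S\<^sub>n\<close> is a combination of two consecutive instances
  of the three-term recurrence for the Stieltjes--Wigert polynomials \<open>S\<^sub>n\<close>.\<close>

lemma four_term_from_three_term:
  fixes q M c w :: complex
  assumes "q \<noteq> 0" "M \<noteq> 0"
    and R1: "(1 - q * q * M) * S\<^sub>2 = (w * (q * M) * (q * q * M) + 1 + q - q * q * M) * S\<^sub>1 - q * S\<^sub>0"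
    and R2: "(1 - q * q * q * M) * S\<^sub>3 =
      (w * (q * q * M) * (q * q * q * M) + 1 + q - q * q * q * M) * S\<^sub>2 - q * S\<^sub>1"
  shows "(1 - c * (q * q * M)) * q ^ 3 * S\<^sub>3 * ((q * q * q * M - 1) * q\<^sup>2 / (q * q * q * M) ^ 3)
    + q\<^sup>2 * S\<^sub>2 * ((1 - (q * q * M - 1) * q * (q + 1) - c * q * w * (q * q * M) ^ 3
        + (c * q + q * w) * (q * q * M)\<^sup>2 - c * (q + 1) * (q * q * M)) / (q * q * M) ^ 3)
    + q * S\<^sub>1 * ((c * (q * M) - 1 - 1 / q + q * (q * M - 1) - q * w * (q * M)\<^sup>2) / (q * M) ^ 3)
    + S\<^sub>0 / (q * M ^ 3) = 0" (is "?a + ?b + ?c + ?d = 0")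
proof -
  \<comment> \<open>The outer two terms are brought to multiples of the left side of
    \<open>R2\<close> and of the last term of \<open>R1\<close>. Eliminating them leaves a
    combination of the middle two unknowns whose coefficients vanish identically.\<close>
  have a: "?a = - (1 - c * (q * q * M)) / (q ^ 4 * M ^ 3) * ((1 - q * q * q * M) * S\<^sub>3)"
    using assms(1,2) by (simp add: divide_simps) (simp add: algebra_simps eval_nat_numeral)
  have "q * S\<^sub>0 = (w * (q * M) * (q * q * M) + 1 + q - q * q * M) * S\<^sub>1 - (1 - q * q * M) * S\<^sub>2"
    using R1 by (simp add: algebra_simps)
  then have d: "?d = ((w * (q * M) * (q * q * M) + 1 + q - q * q * M) * S\<^sub>1 - (1 - q * q * M) * S\<^sub>2) / (q\<^sup>2 * M ^ 3)"
    using assms(1,2) by (simp add: divide_simps power2_eq_square mult_ac)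
  show ?thesis
    unfolding a R2 d using assms(1,2)
    by (simp add: divide_simps) (simp add: algebra_simps eval_nat_numeral)
qed

text \<open>With u = s A / x and r = A / B, the left side is, up to a constant, the image of the
  n-th basis function of (ii). The factor 1 - u completes (q u; q)_n to (u; q)_{n+1}. For n > 0
  everything is then divisible by (u; q)_{n-1}, and the quotients are polynomials of degree at most
  three in u. For n = 0 there is no such common factor, but the coefficient of the lowest symbol is
  zero.\<close>

lemma q_poch_three_term:
  fixes q c r u :: complex and n :: nat
  defines "M \<equiv> q ^ n"
  assumes "q \<noteq> 0"
  shows "u\<^sup>2 * q_poch (u / q) q n + q * c\<^sup>2 * (r - u) * ((1 - u) * q_poch (u * q) q n)
      - (q * c\<^sup>2 * r - q * c * (1 + r) * u + c * (q + 1) * u\<^sup>2) * q_poch u q n =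
    (M - 1) * q\<^sup>2 / M ^ 3 * q_poch u q (n - 1)
    + (1 - (M - 1) * q * (q + 1) - c * q * (c * r) * M ^ 3 + (c * q + q * (c * r)) * M\<^sup>2
        - c * (q + 1) * M) / M ^ 3 * q_poch u q n
    + (1 - c * M) * (c * M - 1 - 1 / q + q * (M - 1) - q * (c * r) * M\<^sup>2) / M ^ 3 * q_poch u q (Suc n)
    + (1 - c * M) * (1 - c * q * M) / (q * M ^ 3) * q_poch u q (Suc (Suc n))"
proof (cases n)
  case 0
  then show ?thesis
    using assms(2) by (simp add: M_def q_poch_Suc divide_simps) (simp add: algebra_simps eval_nat_numeral)
next
  case (Suc k)
  define N F where "N = q ^ k" and "F = q_poch u q k"
  have "N \<noteq> 0" using assms by (simp add: N_def)
  have 1: "q_poch (u / q) q n = (1 - u / q) * F"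
    using assms by (simp add: Suc q_poch_Suc_shift F_def)
  have 2: "(1 - u) * q_poch (u * q) q n = F * (1 - u * N) * (1 - u * (q * N))"
    unfolding q_poch_Suc_shift[symmetric] by (simp add: Suc q_poch_Suc F_def N_def)
  have 3: "q_poch u q (n - 1) = F" "q_poch u q n = F * (1 - u * N)"
    "q_poch u q (Suc n) = F * (1 - u * N) * (1 - u * (q * N))"
    "q_poch u q (Suc (Suc n)) = F * (1 - u * N) * (1 - u * (q * N)) * (1 - u * (q * (q * N)))"
    by (simp_all add: Suc q_poch_Suc F_def N_def)
  have M: "M = q * N" by (simp add: M_def N_def Suc)
  show ?thesis
    unfolding 1 2 3 M using assms(2) \<open>N \<noteq> 0\<close>
    by (simp add: divide_simps) (simp add: algebra_simps eval_nat_numeral)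
qed

section \<open>The equation in reduced parameters\<close>

locale q_equation = nonroot q for q :: complex +
  fixes L \<alpha> lam A B :: complex
  assumes exp_L: "exp L = q" and A_nonzero [simp]: "A \<noteq> 0" and B_nonzero [simp]: "B \<noteq> 0"
begin

abbreviation "s \<equiv> q_pow L (1/2)"
abbreviation "\<Lambda> \<equiv> q_pow L lam"
abbreviation "P \<equiv> q_pow L \<alpha>"
abbreviation "c \<equiv> \<Lambda> * P"

text \<open>The parameters h and t enter only through A and B. The expression is symmetric in A and
  B, so one computation serves both choices of (i, i').\<close>

definition lhs :: "complex \<Rightarrow> complex \<Rightarrow> complex \<Rightarrow> complex \<Rightarrow> complex" where
  "lhs x gqx gxq gx = gqx + \<Lambda>\<^sup>2 * q * (1 - x / (s * A)) * (1 - x / (s * B)) * gxq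
     - (P * \<Lambda>\<^sup>2 / (A * B) * x\<^sup>2 - \<Lambda> * s * (1 / A + 1 / B) * x + \<Lambda> * (q + 1)) * gx"

text \<open>Turns identities that mix q with its square root s into rational identities in
  s.\<close>

lemma q_eq: "q = s * s"
  using q_pow_half[of L] exp_L by simp

lemma subst_lhs_scale:
  "subst_lhs q L lhs \<mu> (\<lambda>x. a * f x) x = a * subst_lhs q L lhs \<mu> f x"
  by (simp add: subst_lhs_def lhs_def algebra_simps)

text \<open>The equation in the variable 1/x. The factor q = s * s in the coefficient of g(x/q) is
  shared out between the two linear factors.\<close>

lemma lhs_div_square:
  assumes "x \<noteq> 0"
  shows "lhs x X Y Z / x\<^sup>2 = (1/x)\<^sup>2 * X + \<Lambda>\<^sup>2 * (s * (1/x) - 1 / A) * (s * (1/x) - 1 / B) * Y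
    - (P * \<Lambda>\<^sup>2 / (A * B) - \<Lambda> * s * (1 / A + 1 / B) * (1/x) + \<Lambda> * (q + 1) * (1/x)\<^sup>2) * Z"
  unfolding lhs_def using assms
  by (simp add: q_eq divide_simps) (simp add: algebra_simps power2_eq_square)

text \<open>Separates the two tasks for a basis in 1/x: computing the image of a single basis
  function, and checking the resulting recurrence for the coefficients \<open>a\<close>.\<close>

lemma formal_solution_inverse_x_bandI:
  assumes "basis_inverse_x \<phi>"
    and u: "\<And>n x. u n x = a n * \<phi> n x"
    and expand: "\<And>n x. x \<noteq> 0 \<Longrightarrow> subst_lhs q L lhs \<mu> (\<phi> n) x / x\<^sup>2 =
      e\<^sub>0 n * \<phi> (n - 1) x + e\<^sub>1 n * \<phi> n x + e\<^sub>2 n * \<phi> (Suc n) x + e\<^sub>3 n * \<phi> (Suc (Suc n)) x"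
    and "e\<^sub>0 0 = 0"
    and "a 1 * e\<^sub>0 1 + a 0 * e\<^sub>1 0 = 0"
    and "a 2 * e\<^sub>0 2 + a 1 * e\<^sub>1 1 + a 0 * e\<^sub>2 0 = 0"
    and "\<And>m. a (Suc (Suc (Suc m))) * e\<^sub>0 (Suc (Suc (Suc m))) + a (Suc (Suc m)) * e\<^sub>1 (Suc (Suc m))
            + a (Suc m) * e\<^sub>2 (Suc m) + a m * e\<^sub>3 m = 0"
  shows "formal_solution q L lhs \<mu> \<phi> u"
proof -
  have "u n = (\<lambda>x. a n * \<phi> n x)" for n
    using u by blast
  then have "coefficients_cancel \<phi> (\<lambda>n x. subst_lhs q L lhs \<mu> (u n) x / x\<^sup>2)"
    using assms(4-) by (intro coefficients_cancel_band[where e\<^sub>0 = "\<lambda>n. a n * e\<^sub>0 n" and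
        e\<^sub>1 = "\<lambda>n. a n * e\<^sub>1 n" and e\<^sub>2 = "\<lambda>n. a n * e\<^sub>2 n" and e\<^sub>3 = "\<lambda>n. a n * e\<^sub>3 n"])
      (simp_all add: subst_lhs_scale expand distrib_left mult.assoc flip: times_divide_eq_right)
  then show ?thesis
    unfolding formal_solution_def using u assms(1) by blast
qed

text \<open>Counterpart for a basis in x, where nothing is divided by the square of x.\<close>

lemma formal_solution_x_bandI:
  assumes "basis_x \<phi>"
    and u: "\<And>n x. u n x = a n * \<phi> n x"
    and expand: "\<And>n x. x \<noteq> 0 \<Longrightarrow> subst_lhs q L lhs \<mu> (\<phi> n) x =
      e\<^sub>0 n * \<phi> (n - 1) x + e\<^sub>1 n * \<phi> n x + e\<^sub>2 n * \<phi> (Suc n) x + e\<^sub>3 n * \<phi> (Suc (Suc n)) x"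
    and "e\<^sub>0 0 = 0"
    and "a 1 * e\<^sub>0 1 + a 0 * e\<^sub>1 0 = 0"
    and "a 2 * e\<^sub>0 2 + a 1 * e\<^sub>1 1 + a 0 * e\<^sub>2 0 = 0"
    and "\<And>m. a (Suc (Suc (Suc m))) * e\<^sub>0 (Suc (Suc (Suc m))) + a (Suc (Suc m)) * e\<^sub>1 (Suc (Suc m))
            + a (Suc m) * e\<^sub>2 (Suc m) + a m * e\<^sub>3 m = 0"
  shows "formal_solution q L lhs \<mu> \<phi> u"
proof -
  have "u n = (\<lambda>x. a n * \<phi> n x)" for n
    using u by blast
  then have "coefficients_cancel \<phi> (\<lambda>n. subst_lhs q L lhs \<mu> (u n))"
    using assms(4-) by (intro coefficients_cancel_band[where e\<^sub>0 = "\<lambda>n. a n * e\<^sub>0 n" and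
        e\<^sub>1 = "\<lambda>n. a n * e\<^sub>1 n" and e\<^sub>2 = "\<lambda>n. a n * e\<^sub>2 n" and e\<^sub>3 = "\<lambda>n. a n * e\<^sub>3 n"])
      (simp_all add: subst_lhs_scale expand distrib_left mult.assoc)
  then show ?thesis
    unfolding formal_solution_def using u assms(1) by blast
qed

section \<open>Solution (i): powers of 1/x\<close>

text \<open>The exponent -\<alpha> is the one for which the lowest coefficient vanishes at n = 0.
  With M = q^n, the top coefficient 1 / (P M) - \<Lambda> (q + 1) + \<Lambda>^2 q P M factors, and
  its zeros match the factors of (c; q)_n.\<close>

lemma subst_lhs_inverse_power:
  assumes "x \<noteq> 0"
  shows "subst_lhs q L lhs (- \<alpha>) (\<lambda>x. inverse x ^ n) x / x\<^sup>2 =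
    c * \<Lambda> / (A * B) * (q ^ n - 1) * inverse x ^ n
    + \<Lambda> * s * (1 / A + 1 / B) * (1 - c * q ^ n) * inverse x ^ Suc n
    + (1 - c * q ^ n) * (1 - c * q ^ Suc n) / (P * q ^ n) * inverse x ^ Suc (Suc n)"
proof -
  have [simp]: "inverse (q * x) ^ n = inverse x ^ n / q ^ n" "inverse (x / q) ^ n = inverse x ^ n * q ^ n"
    by (simp_all add: field_simps)
  define F M where "F = inverse x ^ n" and "M = q ^ n"
  have [simp]: "M \<noteq> 0" by (simp add: M_def)
  show ?thesis
    unfolding subst_lhs_def lhs_div_square[OF assms]
    using assms by (simp add: q_pow_minus F_def[symmetric] M_def[symmetric] divide_simps)
     (simp add: q_eq algebra_simps power2_eq_square)
qed

theorem formal_solution_inverse_power: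
  "formal_solution q L lhs (- \<alpha>) (\<lambda>n x. inverse x ^ n)
     (\<lambda>n x. (s / c * inverse x) ^ n * q_poch c q n * rogers_szego A B n)"
proof -
  define a where "a n = (s / c) ^ n * q_poch c q n * rogers_szego A B n" for n
  show ?thesis
  proof (rule formal_solution_inverse_x_bandI[OF basis_inverse_x_power, where a = a and e\<^sub>0 = "\<lambda>_. 0"
        and e\<^sub>1 = "\<lambda>n. c * \<Lambda> / (A * B) * (q ^ n - 1)"
        and e\<^sub>2 = "\<lambda>n. \<Lambda> * s * (1 / A + 1 / B) * (1 - c * q ^ n)"
        and e\<^sub>3 = "\<lambda>n. (1 - c * q ^ n) * (1 - c * q ^ Suc n) / (P * q ^ n)"])
    fix m
    define S\<^sub>0 S\<^sub>1 S\<^sub>2 where "S\<^sub>0 = rogers_szego A B m" and "S\<^sub>1 = rogers_szego A B (Suc m)"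
      and "S\<^sub>2 = rogers_szego A B (Suc (Suc m))"
    define C M where "C = (s / c) ^ m * q_poch c q m" and "M = q ^ m"
    have [simp]: "M \<noteq> 0" by (simp add: M_def)
    have rec: "(1 - q * q * M) * S\<^sub>2 = (A + B) * S\<^sub>1 + A * B / (q * M) * S\<^sub>0"
      using rogers_szego_rec[of m A B] by (simp add: S\<^sub>0_def S\<^sub>1_def S\<^sub>2_def M_def mult.assoc)
    \<comment> \<open>The common factor is (s/c)^m (c; q)_{m+2}. What remains is the Rogers--Szego
      recurrence up to a constant.\<close>
    have "a (Suc (Suc m)) * (c * \<Lambda> / (A * B) * (q ^ Suc (Suc m) - 1))
        + a (Suc m) * (\<Lambda> * s * (1 / A + 1 / B) * (1 - c * q ^ Suc m))
        + a m * ((1 - c * q ^ m) * (1 - c * q ^ Suc m) / (P * q ^ m)) =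
      C * (1 - c * M) * (1 - c * (q * M)) * (- (s * s) / c\<^sup>2 * (c * \<Lambda> / (A * B)) * ((1 - q * q * M) * S\<^sub>2)
        + s / c * (\<Lambda> * s * (1 / A + 1 / B)) * S\<^sub>1 + S\<^sub>0 / (P * M))"
      by (simp add: a_def q_poch_Suc C_def M_def S\<^sub>0_def S\<^sub>1_def S\<^sub>2_def algebra_simps power2_eq_square
          add_divide_distrib diff_divide_distrib)
    also have "- (s * s) / c\<^sup>2 * (c * \<Lambda> / (A * B)) * ((1 - q * q * M) * S\<^sub>2)
        + s / c * (\<Lambda> * s * (1 / A + 1 / B)) * S\<^sub>1 + S\<^sub>0 / (P * M) = 0"
      unfolding rec q_eq[symmetric]
      by (simp add: q_eq divide_simps power2_eq_square; simp add: algebra_simps)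
    finally show "a (Suc (Suc (Suc m))) * 0
        + a (Suc (Suc m)) * (c * \<Lambda> / (A * B) * (q ^ Suc (Suc m) - 1))
        + a (Suc m) * (\<Lambda> * s * (1 / A + 1 / B) * (1 - c * q ^ Suc m))
        + a m * ((1 - c * q ^ m) * (1 - c * q ^ Suc m) / (P * q ^ m)) = 0"
      by simp
  next
    have S\<^sub>1: "rogers_szego A B 1 = (A + B) / (1 - q)"
      using rogers_szego_1[of A B] by (simp add: field_simps)
    show "a 2 * 0 + a 1 * (c * \<Lambda> / (A * B) * (q ^ 1 - 1))
        + a 0 * (\<Lambda> * s * (1 / A + 1 / B) * (1 - c * q ^ 0)) = 0"
      unfolding a_def S\<^sub>1 by (simp add: q_poch_Suc divide_simps) (simp add: algebra_simps)
  next
    show "(s / c * inverse x) ^ n * q_poch c q n * rogers_szego A B n = a n * inverse x ^ n" for n x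
      unfolding a_def by (simp only: power_mult_distrib mult_ac)
  qed (simp_all add: subst_lhs_inverse_power)
qed

section \<open>Solution (ii): Pochhammer symbols in 1/x\<close>

text \<open>Replacing x by q x or x/q replaces u = s A / x by u/q or q u. Multiplication by q A^2 P
  then gives the left side of \<open>q_poch_three_term\<close> with r = A / B.\<close>

lemma subst_lhs_q_poch:
  assumes "x \<noteq> 0"
  shows "subst_lhs q L lhs (- \<alpha>) (\<lambda>x. q_poch (s * A / x) q n) x / x\<^sup>2 =
    ((q ^ n - 1) * q\<^sup>2 / (q ^ n) ^ 3) / (q * A\<^sup>2 * P) * q_poch (s * A / x) q (n - 1)
    + ((1 - (q ^ n - 1) * q * (q + 1) - c * q * (c * A / B) * (q ^ n) ^ 3 + (c * q + q * (c * A / B)) * (q ^ n)\<^sup>2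
        - c * (q + 1) * q ^ n) / (q ^ n) ^ 3) / (q * A\<^sup>2 * P) * q_poch (s * A / x) q n
    + ((1 - c * q ^ n) * (c * q ^ n - 1 - 1 / q + q * (q ^ n - 1) - q * (c * A / B) * (q ^ n)\<^sup>2) / (q ^ n) ^ 3)
        / (q * A\<^sup>2 * P) * q_poch (s * A / x) q (Suc n)
    + ((1 - c * q ^ n) * (1 - c * q * q ^ n) / (q * (q ^ n) ^ 3)) / (q * A\<^sup>2 * P)
        * q_poch (s * A / x) q (Suc (Suc n))" (is "_ = ?rhs")
proof -
  define u X Y Z where "u = s * A / x" and "X = q_poch (u / q) q n" and "Y = q_poch (u * q) q n"
    and "Z = q_poch u q n"
  have y: "1 / x = u / (s * A)"
    by (simp add: u_def)
  have lhs: "subst_lhs q L lhs (- \<alpha>) (\<lambda>x. q_poch (s * A / x) q n) x = lhs x (X / P) (P * Y) Z"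
  proof -
    have "s * A / (q * x) = u / q" "s * A / (x / q) = u * q" "s * A / x = u"
      by (simp_all add: u_def)
    then show ?thesis
      by (simp add: subst_lhs_def q_pow_minus X_def Y_def Z_def inverse_eq_divide)
  qed
  have "subst_lhs q L lhs (- \<alpha>) (\<lambda>x. q_poch (s * A / x) q n) x / x\<^sup>2 =
      (u\<^sup>2 * X + q * c\<^sup>2 * (A / B - u) * ((1 - u) * Y)
      - (q * c\<^sup>2 * (A / B) - q * c * (1 + A / B) * u + c * (q + 1) * u\<^sup>2) * Z) / (q * A\<^sup>2 * P)"
    unfolding lhs lhs_div_square[OF assms] y
    by (simp add: q_eq divide_simps) (simp add: algebra_simps power2_eq_square)
  also have "\<dots> = ?rhs"
    unfolding X_def Y_def Z_def q_poch_three_term[OF q_nonzero] u_def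
    by (simp add: add_divide_distrib)
  finally show ?thesis .
qed

theorem formal_solution_q_poch:
  "formal_solution q L lhs (- \<alpha>) (\<lambda>n x. q_poch (s * A / x) q n)
     (\<lambda>n x. q_poch (s * A / x) q n * q_poch c q n * q ^ n * stieltjes_wigert (c * A / B) n)"
proof -
  define w where "w = c * A / B"
  define a where "a n = q_poch c q n * q ^ n * stieltjes_wigert w n" for n
  define d\<^sub>0 where "d\<^sub>0 M = (M - 1) * q\<^sup>2 / M ^ 3" for M
  define d\<^sub>1 where "d\<^sub>1 M = (1 - (M - 1) * q * (q + 1) - c * q * w * M ^ 3 + (c * q + q * w) * M\<^sup>2
        - c * (q + 1) * M) / M ^ 3" for M
  define d\<^sub>2 where "d\<^sub>2 M = (1 - c * M) * (c * M - 1 - 1 / q + q * (M - 1) - q * w * M\<^sup>2) / M ^ 3" for M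
  define d\<^sub>3 where "d\<^sub>3 M = (1 - c * M) * (1 - c * q * M) / (q * M ^ 3)" for M
  define \<kappa> where "\<kappa> = q * A\<^sup>2 * P"
  show ?thesis
  proof (rule formal_solution_inverse_x_bandI[where a = a and e\<^sub>0 = "\<lambda>n. d\<^sub>0 (q ^ n) / \<kappa>"
        and e\<^sub>1 = "\<lambda>n. d\<^sub>1 (q ^ n) / \<kappa>" and e\<^sub>2 = "\<lambda>n. d\<^sub>2 (q ^ n) / \<kappa>" and e\<^sub>3 = "\<lambda>n. d\<^sub>3 (q ^ n) / \<kappa>"])
    show "basis_inverse_x (\<lambda>n x. q_poch (s * A / x) q n)"
      by (rule basis_inverse_x_q_poch) simp_all
  next
    fix m
    define C M where "C = q_poch c q m" and "M = q ^ m"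
    define S where "S i = stieltjes_wigert w (m + i)" for i
    \<comment> \<open>This is q^m (c; q)_{m+2}, the common factor of all four terms. Where
      \<open>a\<close> has too few factors of (c; q), the coefficients of the two higher basis
      functions supply the missing ones.\<close>
    let ?k = "C * M * (1 - c * M) * (1 - c * (q * M))"
    have [simp]: "M \<noteq> 0" by (simp add: M_def)
    have t0: "a (Suc (Suc (Suc m))) * d\<^sub>0 (q ^ Suc (Suc (Suc m))) =
      ?k * ((1 - c * (q * q * M)) * q ^ 3 * S 3 * ((q * q * q * M - 1) * q\<^sup>2 / (q * q * q * M) ^ 3))"
      by (simp add: a_def d\<^sub>0_def q_poch_Suc C_def M_def S_def eval_nat_numeral mult_ac)
    have t1: "a (Suc (Suc m)) * d\<^sub>1 (q ^ Suc (Suc m)) =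
      ?k * (q\<^sup>2 * S 2 * ((1 - (q * q * M - 1) * q * (q + 1) - c * q * w * (q * q * M) ^ 3
        + (c * q + q * w) * (q * q * M)\<^sup>2 - c * (q + 1) * (q * q * M)) / (q * q * M) ^ 3))"
      by (simp add: a_def d\<^sub>1_def q_poch_Suc C_def M_def S_def eval_nat_numeral mult_ac)
    have t2: "a (Suc m) * d\<^sub>2 (q ^ Suc m) =
      ?k * (q * S 1 * ((c * (q * M) - 1 - 1 / q + q * (q * M - 1) - q * w * (q * M)\<^sup>2) / (q * M) ^ 3))"
      by (simp add: a_def d\<^sub>2_def q_poch_Suc C_def M_def S_def eval_nat_numeral mult_ac)
    have t3: "a m * d\<^sub>3 (q ^ m) = ?k * (S 0 / (q * M ^ 3))"
      by (simp add: a_def d\<^sub>3_def q_poch_Suc C_def M_def S_def eval_nat_numeral mult_ac)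
    have R1: "(1 - q * q * M) * S 2 = (w * (q * M) * (q * q * M) + 1 + q - q * q * M) * S 1 - q * S 0"
      using stieltjes_wigert_rec[of m w] by (simp add: M_def S_def mult.assoc)
    have R2: "(1 - q * q * q * M) * S 3 =
        (w * (q * q * M) * (q * q * q * M) + 1 + q - q * q * q * M) * S 2 - q * S 1"
      using stieltjes_wigert_rec[of "Suc m" w] by (simp add: M_def S_def mult.assoc eval_nat_numeral)
    have "a (Suc (Suc (Suc m))) * d\<^sub>0 (q ^ Suc (Suc (Suc m))) + a (Suc (Suc m)) * d\<^sub>1 (q ^ Suc (Suc m))
            + a (Suc m) * d\<^sub>2 (q ^ Suc m) + a m * d\<^sub>3 (q ^ m) = 0"
      unfolding t0 t1 t2 t3
      using four_term_from_three_term[OF q_nonzero \<open>M \<noteq> 0\<close> R1 R2, of c]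
      by (simp only: distrib_left[symmetric] mult_zero_right)
    then show "a (Suc (Suc (Suc m))) * (d\<^sub>0 (q ^ Suc (Suc (Suc m))) / \<kappa>)
        + a (Suc (Suc m)) * (d\<^sub>1 (q ^ Suc (Suc m)) / \<kappa>)
        + a (Suc m) * (d\<^sub>2 (q ^ Suc m) / \<kappa>) + a m * (d\<^sub>3 (q ^ m) / \<kappa>) = 0"
      by (simp flip: add_divide_distrib)
  next
    have S1: "stieltjes_wigert w 1 = (1 + q * w) / (1 - q)"
      using stieltjes_wigert_1[of w] by (simp add: field_simps)
    show "a 1 * (d\<^sub>0 (q ^ 1) / \<kappa>) + a 0 * (d\<^sub>1 (q ^ 0) / \<kappa>) = 0"
      unfolding a_def S1 d\<^sub>0_def d\<^sub>1_def
      by (simp add: q_poch_Suc \<kappa>_def divide_simps) (simp add: algebra_simps eval_nat_numeral)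
    \<comment> \<open>For the coefficient of \<phi>_1 only one three-term relation is available. The
      explicit value of the polynomial of degree one replaces the other.\<close>
    have S2: "(1 - q\<^sup>2) * stieltjes_wigert w 2 = (w * q * q\<^sup>2 + 1 + q - q\<^sup>2) * stieltjes_wigert w 1 - q"
      using stieltjes_wigert_rec[of 0 w] by (simp add: eval_nat_numeral)
    show "a 2 * (d\<^sub>0 (q ^ 2) / \<kappa>) + a 1 * (d\<^sub>1 (q ^ 1) / \<kappa>) + a 0 * (d\<^sub>2 (q ^ 0) / \<kappa>) = 0"
    proof -
      define S where "S = stieltjes_wigert w 1"
      have "a 2 * d\<^sub>0 (q ^ 2) = - (1 - c) * (1 - c * q) / q\<^sup>2 * ((1 - q\<^sup>2) * stieltjes_wigert w 2)"
        by (simp add: a_def d\<^sub>0_def q_poch_Suc divide_simps eval_nat_numeral) (simp add: algebra_simps)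
      also have "(1 - q\<^sup>2) * stieltjes_wigert w 2 = (w * q * q\<^sup>2 + 1 + q - q\<^sup>2) * S - q"
        by (simp add: S2 S_def)
      finally have t0: "a 2 * d\<^sub>0 (q ^ 2) =
        - (1 - c) * (1 - c * q) / q\<^sup>2 * ((w * q * q\<^sup>2 + 1 + q - q\<^sup>2) * S - q)" .
      have t1: "a 1 * d\<^sub>1 (q ^ 1) = (1 - c) * q * S * d\<^sub>1 q" and t2: "a 0 * d\<^sub>2 (q ^ 0) = d\<^sub>2 1"
        by (simp_all add: a_def S_def q_poch_Suc)
      have "a 2 * d\<^sub>0 (q ^ 2) + a 1 * d\<^sub>1 (q ^ 1) + a 0 * d\<^sub>2 (q ^ 0) = 0"
        unfolding t0 t1 t2
        unfolding d\<^sub>1_def d\<^sub>2_def S_def S1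
        by (simp add: divide_simps eval_nat_numeral) (simp add: algebra_simps)
      then show ?thesis
        by (simp only: times_divide_eq_right add_divide_distrib[symmetric] div_0)
    qed
  next
    fix n x :: complex
    show "d\<^sub>0 (q ^ 0) / \<kappa> = 0"
      by (simp add: d\<^sub>0_def)
  qed (simp_all add: subst_lhs_q_poch a_def d\<^sub>0_def d\<^sub>1_def d\<^sub>2_def d\<^sub>3_def \<kappa>_def w_def)
qed

section \<open>Solution (iii): Pochhammer symbols times powers of x\<close>

text \<open>Newton expansion of a cubic in x at the nodes K q^(n-1), K q^n and K q^(n+1), where M =
  q^(n-1). The cubic is the image of \<phi>_n divided by \<Lambda> \<phi>_{n-1}.\<close>

lemma q_poch_power_identity:
  fixes M K r x :: complex
  assumes "M \<noteq> 0" "K \<noteq> 0"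
  defines "p\<^sub>1 \<equiv> x - K * M" and "p\<^sub>2 \<equiv> x - K * (q * M)" and "p\<^sub>3 \<equiv> x - K * (q * (q * M))"
  shows "M * (q * x - K) - (1 - r * x / K) * p\<^sub>1 * p\<^sub>2 / (K * M)
      - (c * q * r / K\<^sup>2 * x\<^sup>2 - q * (1 + r) / K * x + (q + 1)) * p\<^sub>1 =
    K * (q * M / q) * (q * M - 1)
    + ((q + 1) * (q * M - 1) + q * r * (q * M) * (1 - c * (q * M))) * p\<^sub>1
    + (- (q / (q * M)) * (1 - q * M) + q * r * (q + 1) * (1 - c * (q * M))) / K * (p\<^sub>1 * p\<^sub>2)
    + (q * r / (q * M) * (1 - c * (q * M))) / K\<^sup>2 * (p\<^sub>1 * p\<^sub>2 * p\<^sub>3)"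
  unfolding p\<^sub>1_def p\<^sub>2_def p\<^sub>3_def using assms(1,2)
  by (simp add: divide_simps) (simp add: algebra_simps eval_nat_numeral)

lemma subst_lhs_q_poch_power:
  assumes "x \<noteq> 0"
  shows "subst_lhs q L lhs lam (\<lambda>x. q_poch (s * A / x) q n * x ^ n) x =
    \<Lambda> * (s * A) * (q ^ n / q) * (q ^ n - 1) * (q_poch (s * A / x) q (n - 1) * x ^ (n - 1))
    + \<Lambda> * ((q + 1) * (q ^ n - 1) + q * (A / B) * q ^ n * (1 - c * q ^ n)) * (q_poch (s * A / x) q n * x ^ n)
    + \<Lambda> / (s * A) * (- (q / q ^ n) * (1 - q ^ n) + q * (A / B) * (q + 1) * (1 - c * q ^ n))
        * (q_poch (s * A / x) q (Suc n) * x ^ Suc n)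
    + \<Lambda> / (s * A)\<^sup>2 * (q * (A / B) / q ^ n * (1 - c * q ^ n)) * (q_poch (s * A / x) q (Suc (Suc n)) * x ^ Suc (Suc n))"
proof -
  define K u where "K = s * A" and "u = K / x"
  have [simp]: "K \<noteq> 0" "u \<noteq> 0" using assms by (simp_all add: K_def u_def)
  have x: "x = K / u" by (simp add: u_def)
  have B: "s * B = K / (A / B)" by (simp add: K_def)
  show ?thesis
  proof (cases n)
    case 0
    then show ?thesis
      using assms by (simp add: subst_lhs_def lhs_def q_poch_Suc q_pow_minus divide_simps)
       (simp add: q_eq algebra_simps power2_eq_square)
  next
    case (Suc k)
    define M F where "M = q ^ k" and "F = q_poch u q k"
    have [simp]: "M \<noteq> 0" by (simp add: M_def)
    have 1: "q_poch (K / (q * x)) q n = (1 - u / q) * F"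
      by (simp add: Suc q_poch_Suc_shift F_def u_def)
    \<comment> \<open>The zero of the coefficient of g(x/q) at x = K supplies the factor 1 - u that
      completes (q u; q)_n to (u; q)_{n+1}.\<close>
    have 2: "(1 - x / K) * q_poch (K / (x / q)) q n = - (x / K) * F * (1 - u * M) * (1 - u * (q * M))"
    proof -
      have "1 - x / K = - (x / K) * (1 - u)"
        using assms by (simp add: u_def field_simps)
      moreover have "(1 - u) * q_poch (K / (x / q)) q n = F * (1 - u * M) * (1 - u * (q * M))"
        using q_poch_Suc_shift[of u q n] by (simp add: Suc q_poch_Suc F_def M_def u_def)
      ultimately show ?thesis by simp
    qed
    have 3: "q_poch u q (n - 1) = F" "q_poch u q n = F * (1 - u * M)"
      "q_poch u q (Suc n) = F * (1 - u * M) * (1 - u * (q * M))"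
      "q_poch u q (Suc (Suc n)) = F * (1 - u * M) * (1 - u * (q * M)) * (1 - u * (q * (q * M)))"
      by (simp_all add: Suc q_poch_Suc F_def M_def)
    define r p\<^sub>1 p\<^sub>2 p\<^sub>3 where "r = A / B" and "p\<^sub>1 = x - K * M" and "p\<^sub>2 = x - K * (q * M)"
      and "p\<^sub>3 = x - K * (q * (q * M))"
    have p: "(1 - u * M) * x = p\<^sub>1" "(1 - u * (q * M)) * x = p\<^sub>2" "(1 - u * (q * (q * M))) * x = p\<^sub>3"
      using assms by (simp_all add: u_def p\<^sub>1_def p\<^sub>2_def p\<^sub>3_def field_simps)
    have pow: "q_poch u q n * x ^ n = F * x ^ k * p\<^sub>1"
      "q_poch u q (Suc n) * x ^ Suc n = F * x ^ k * (p\<^sub>1 * p\<^sub>2)"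
      "q_poch u q (Suc (Suc n)) * x ^ Suc (Suc n) = F * x ^ k * (p\<^sub>1 * p\<^sub>2 * p\<^sub>3)"
      unfolding 3 p[symmetric] by (simp_all add: Suc)
    have "subst_lhs q L lhs lam (\<lambda>x. q_poch (s * A / x) q n * x ^ n) x =
      \<Lambda> * ((1 - u / q) * F * (q * M * x ^ n)
       + q * (1 - x / (s * B)) * ((1 - x / K) * q_poch (K / (x / q)) q n) * (x ^ n / (q * M))
       - (c / (A * B) * x\<^sup>2 - s * (1 / A + 1 / B) * x + (q + 1)) * (q_poch u q n * x ^ n))"
      unfolding subst_lhs_def lhs_def K_def[symmetric] 1 u_def[symmetric]
      by (simp add: q_pow_minus Suc M_def power_mult_distrib power_divide divide_simps)
        (simp add: algebra_simps power2_eq_square)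
    also have "\<dots> = \<Lambda> * F * x ^ k * (M * (q * x - K) - (1 - r * x / K) * p\<^sub>1 * p\<^sub>2 / (K * M)
      - (c * q * r / K\<^sup>2 * x\<^sup>2 - q * (1 + r) / K * x + (q + 1)) * p\<^sub>1)"
    proof -
      have 4: "(1 - u / q) * F * (q * M * x ^ n) = F * x ^ k * (M * (q * x - K))"
        using assms by (simp add: Suc u_def field_simps)
      have 5: "q * (1 - x / (s * B)) * (- (x / K) * F * (1 - u * M) * (1 - u * (q * M))) * (x ^ n / (q * M))
          = - (F * x ^ k * ((1 - r * x / K) * p\<^sub>1 * p\<^sub>2 / (K * M)))"
        unfolding p[symmetric] by (simp add: Suc r_def K_def mult_ac)
      have 6: "c / (A * B) = c * q * r / K\<^sup>2" "s * (1 / A + 1 / B) = q * (1 + r) / K"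
        by (simp_all add: K_def r_def q_eq field_simps power2_eq_square)
      show ?thesis
        unfolding 2 4 5 6 pow by (simp add: algebra_simps)
    qed
    also note q_poch_power_identity[OF \<open>M \<noteq> 0\<close> \<open>K \<noteq> 0\<close>, where x = x and r = r, folded p\<^sub>1_def p\<^sub>2_def p\<^sub>3_def]
    finally have expand: "subst_lhs q L lhs lam (\<lambda>x. q_poch (s * A / x) q n * x ^ n) x = \<Lambda> * F * x ^ k * (
      K * (q * M / q) * (q * M - 1)
      + ((q + 1) * (q * M - 1) + q * r * (q * M) * (1 - c * (q * M))) * p\<^sub>1
      + (- (q / (q * M)) * (1 - q * M) + q * r * (q + 1) * (1 - c * (q * M))) / K * (p\<^sub>1 * p\<^sub>2)
      + (q * r / (q * M) * (1 - c * (q * M))) / K\<^sup>2 * (p\<^sub>1 * p\<^sub>2 * p\<^sub>3))" .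
    have 7: "q ^ n = q * M" "q_poch u q (n - 1) * x ^ (n - 1) = F * x ^ k"
      by (simp_all add: Suc M_def F_def)
    have "l * f * y * (K * i * j + e\<^sub>1 * z\<^sub>1 + e\<^sub>2 / K * z\<^sub>2 + e\<^sub>3 / K\<^sup>2 * z\<^sub>3) =
        l * K * i * j * (f * y) + l * e\<^sub>1 * (f * y * z\<^sub>1) + l / K * e\<^sub>2 * (f * y * z\<^sub>2) + l / K\<^sup>2 * e\<^sub>3 * (f * y * z\<^sub>3)"
      for l f y i j e\<^sub>1 e\<^sub>2 e\<^sub>3 z\<^sub>1 z\<^sub>2 z\<^sub>3 :: complex
      by (simp add: algebra_simps)
    then show ?thesis
      unfolding expand unfolding K_def[symmetric] u_def[symmetric] r_def[symmetric] pow 7 .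
  qed
qed

theorem formal_solution_q_poch_power:
  "formal_solution q L lhs lam (\<lambda>n x. q_poch (s * A / x) q n * x ^ n)
     (\<lambda>n x. q_poch (s * A / x) q n * (q_poch c q n / q_poch q q n) * (x * (s / B)) ^ n)"
proof -
  define K where "K = s * A"
  define a where "a n = q_poch c q n / q_poch q q n * (s / B) ^ n" for n
  \<comment> \<open>The quotient of consecutive \<open>a\<close> is such that a_n (1 - c q^n) is a
    constant times b_{n+1}. Hence the image of each term can be written with b_n and b_{n+1}
    alone.\<close>
  define b where "b n = a n * (1 - q ^ n)" for n
  define d\<^sub>0 where "d\<^sub>0 M = \<Lambda> * K * (M / q) * (M - 1)" for M
  define d\<^sub>1 where "d\<^sub>1 M = \<Lambda> * ((q + 1) * (M - 1) + q * (A / B) * M * (1 - c * M))" for M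
  define d\<^sub>2 where "d\<^sub>2 M = \<Lambda> / K * (- (q / M) * (1 - M) + q * (A / B) * (q + 1) * (1 - c * M))" for M
  define d\<^sub>3 where "d\<^sub>3 M = \<Lambda> / K\<^sup>2 * (q * (A / B) / M * (1 - c * M))" for M
  have [simp]: "K \<noteq> 0" by (simp add: K_def)
  have "a n * (1 - c * q ^ n) * (s / B) = b (Suc n)" for n
    by (simp add: a_def b_def q_poch_Suc)
  then have "a n * (1 - c * q ^ n) * (s / B) * K = K * b (Suc n)" for n
    by simp
  then have ratio: "q * (A / B) * (a n * (1 - c * q ^ n)) = K * b (Suc n)" for n
    by (simp add: K_def q_eq mult_ac)
  have t0: "a n * d\<^sub>0 (q ^ n) = - (\<Lambda> * K * (q ^ n / q)) * b n" for n
    by (simp add: d\<^sub>0_def b_def algebra_simps diff_divide_distrib)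
  have t1: "a n * d\<^sub>1 (q ^ n) = \<Lambda> * (q ^ n * K * b (Suc n) - (q + 1) * b n)" for n
  proof -
    have "a n * d\<^sub>1 (q ^ n) = \<Lambda> * (q ^ n * (q * (A / B) * (a n * (1 - c * q ^ n))) - (q + 1) * b n)"
      by (simp add: d\<^sub>1_def b_def algebra_simps diff_divide_distrib)
    then show ?thesis unfolding ratio by (simp add: mult_ac)
  qed
  have t2: "a n * d\<^sub>2 (q ^ n) = \<Lambda> / K * ((q + 1) * K * b (Suc n) - q / q ^ n * b n)" for n
  proof -
    have "a n * d\<^sub>2 (q ^ n) = \<Lambda> / K * ((q + 1) * (q * (A / B) * (a n * (1 - c * q ^ n))) - q / q ^ n * b n)"
      by (simp add: d\<^sub>2_def b_def algebra_simps diff_divide_distrib add_divide_distrib)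
    then show ?thesis unfolding ratio by (simp add: mult_ac)
  qed
  have t3: "a n * d\<^sub>3 (q ^ n) = \<Lambda> / K\<^sup>2 / q ^ n * (K * b (Suc n))" for n
  proof -
    have "a n * d\<^sub>3 (q ^ n) = \<Lambda> / K\<^sup>2 / q ^ n * (q * (A / B) * (a n * (1 - c * q ^ n)))"
      by (simp add: d\<^sub>3_def mult_ac)
    then show ?thesis by (simp only: ratio)
  qed
  \<comment> \<open>This brings the two initial relations under the same cancellation as the general
    one.\<close>
  have "b 0 = 0" by (simp add: b_def)
  show ?thesis
  proof (rule formal_solution_x_bandI[where a = a and e\<^sub>0 = "\<lambda>n. d\<^sub>0 (q ^ n)"
        and e\<^sub>1 = "\<lambda>n. d\<^sub>1 (q ^ n)" and e\<^sub>2 = "\<lambda>n. d\<^sub>2 (q ^ n)" and e\<^sub>3 = "\<lambda>n. d\<^sub>3 (q ^ n)"])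
    show "basis_x (\<lambda>n x. q_poch (s * A / x) q n * x ^ n)"
      by (rule basis_x_q_poch)
    show "q_poch (s * A / x) q n * (q_poch c q n / q_poch q q n) * (x * (s / B)) ^ n =
        a n * (q_poch (s * A / x) q n * x ^ n)" for n x
      unfolding a_def by (simp only: power_mult_distrib mult_ac)
    show "subst_lhs q L lhs lam (\<lambda>x. q_poch (s * A / x) q n * x ^ n) x =
        d\<^sub>0 (q ^ n) * (q_poch (s * A / x) q (n - 1) * x ^ (n - 1))
        + d\<^sub>1 (q ^ n) * (q_poch (s * A / x) q n * x ^ n)
        + d\<^sub>2 (q ^ n) * (q_poch (s * A / x) q (Suc n) * x ^ Suc n)
        + d\<^sub>3 (q ^ n) * (q_poch (s * A / x) q (Suc (Suc n)) * x ^ Suc (Suc n))" if "x \<noteq> 0" for n x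
      unfolding subst_lhs_q_poch_power[OF that] d\<^sub>0_def d\<^sub>1_def d\<^sub>2_def d\<^sub>3_def K_def ..
    show "d\<^sub>0 (q ^ 0) = 0"
      by (simp add: d\<^sub>0_def)
    show "a 1 * d\<^sub>0 (q ^ 1) + a 0 * d\<^sub>1 (q ^ 0) = 0"
      unfolding t0 t1 by (simp add: \<open>b 0 = 0\<close>)
    show "a 2 * d\<^sub>0 (q ^ 2) + a 1 * d\<^sub>1 (q ^ 1) + a 0 * d\<^sub>2 (q ^ 0) = 0"
      unfolding t0 t1 t2 by (simp add: \<open>b 0 = 0\<close> eval_nat_numeral algebra_simps)
    \<comment> \<open>Adjacent terms cancel in pairs: b_{m+3} between the first two, b_{m+2} between
      the middle two, b_{m+1} between the last two.\<close>
    show "a (Suc (Suc (Suc m))) * d\<^sub>0 (q ^ Suc (Suc (Suc m))) + a (Suc (Suc m)) * d\<^sub>1 (q ^ Suc (Suc m))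
        + a (Suc m) * d\<^sub>2 (q ^ Suc m) + a m * d\<^sub>3 (q ^ m) = 0" for m
      unfolding t0 t1 t2 t3 by (simp add: field_simps power2_eq_square)
  qed
qed

end

section \<open>Return to the original parameters\<close>

text \<open>Either order of the indices is allowed because \<open>lhs\<close> is symmetric in A and
  B.\<close>

lemma variant_lhs_eq:
  assumes "q_equation q L A B" "{i, i'} = {1, 2}"
    and "A = q_pow L (h i) * t i" "B = q_pow L (h i') * t i'"
  shows "variant_lhs q L h t \<alpha> lam = q_equation.lhs q L \<alpha> lam A B"
proof -
  interpret q_equation q L \<alpha> lam A B by fact
  let ?A = "\<lambda>j. q_pow L (h j) * t j"
  have double: "q_pow L (2 * a) = (q_pow L a)\<^sup>2" for a
    unfolding mult_2 q_pow_add power2_eq_square ..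
  have "q_pow L 1 = q"
    by (simp add: q_pow_def exp_L)
  then have 1: "q_pow L (2 * lam + 1) = \<Lambda>\<^sup>2 * q"
    by (simp add: q_pow_add double)
  have 2: "q_pow L (- h j - 1/2) * inverse (t j) * x = x / (s * ?A j)" for j x
    unfolding q_pow_diff q_pow_minus by (simp add: field_simps)
  have 3: "q_pow L (\<alpha> + 2 * lam - h 1 - h 2) * inverse (t 1) * inverse (t 2) = P * \<Lambda>\<^sup>2 / (?A 1 * ?A 2)"
    unfolding q_pow_diff q_pow_add double by (simp add: field_simps)
  have 4: "q_pow L (lam + 1/2) * (q_pow L (- h 1) * inverse (t 1) + q_pow L (- h 2) * inverse (t 2)) =
      \<Lambda> * s * (1 / ?A 1 + 1 / ?A 2)"
    unfolding q_pow_minus q_pow_add by (simp add: field_simps)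
  have "(i = 1 \<and> i' = 2) \<or> (i = 2 \<and> i' = 1)"
    using assms(2) by (auto simp: doubleton_eq_iff)
  then show ?thesis
    unfolding fun_eq_iff variant_lhs_def lhs_def
    unfolding 1 2 3 4 assms(3,4) by (auto simp: mult_ac add_ac)
qed

theorem theorem4p1:
  fixes q L \<alpha> lam :: complex and h t :: "nat \<Rightarrow> complex"
  assumes "q \<noteq> 0"
    and "\<And>n::nat. n > 0 \<Longrightarrow> q ^ n \<noteq> 1"
    and "exp L = q"
    and "t 1 \<noteq> 0" and "t 2 \<noteq> 0"
  shows
    "formal_solution q L (variant_lhs q L h t \<alpha> lam) (- \<alpha>)
       (\<lambda>n x. inverse x ^ n)
       (\<lambda>n x. (q_pow L (- lam - \<alpha> + 1/2) * inverse x) ^ n * q_poch (q_pow L (lam + \<alpha>)) q n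
          * (\<Sum>l\<le>n. q powi (- int (l * (n - l)))
               * (q_pow L (h 1) * t 1) ^ (n - l) * (q_pow L (h 2) * t 2) ^ l
               / (q_poch q q (n - l) * q_poch q q l)))
     \<and> (\<forall>(i, i') \<in> {(1, 2), (2, 1)}.
          formal_solution q L (variant_lhs q L h t \<alpha> lam) (- \<alpha>)
            (\<lambda>n x. q_poch (q_pow L (h i + 1/2) * t i / x) q n)
            (\<lambda>n x. q_poch (q_pow L (h i + 1/2) * t i / x) q n
               * q_poch (q_pow L (lam + \<alpha>)) q n * q ^ n
               * (\<Sum>k\<le>n. q ^ (k\<^sup>2) * (q_pow L (lam + \<alpha> + h i - h i') * t i / t i') ^ k
                    / (q_poch q q k * q_poch q q (n - k)))))
     \<and> (\<forall>(i, i') \<in> {(1, 2), (2, 1)}.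
          formal_solution q L (variant_lhs q L h t \<alpha> lam) lam
            (\<lambda>n x. q_poch (q_pow L (h i + 1/2) * t i / x) q n * x ^ n)
            (\<lambda>n x. q_poch (q_pow L (h i + 1/2) * t i / x) q n
               * (q_poch (q_pow L (lam + \<alpha>)) q n / q_poch q q n)
               * (x / (q_pow L (h i' - 1/2) * t i')) ^ n)
        \<and> (\<forall>n x. x \<noteq> 0 \<longrightarrow>
             q_poch (q_pow L (h i + 1/2) * t i / x) q n
               * (q_poch (q_pow L (lam + \<alpha>)) q n / q_poch q q n)
               * (x / (q_pow L (h i' - 1/2) * t i')) ^ n
             = q_hyper_term [q_pow L (lam + \<alpha>), q_pow L (h i + 1/2) * t i / x] [0] q
                 (x / (q_pow L (h i' - 1/2) * t i')) n))"
proof -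
  have eqn: "q_equation q L (q_pow L (h i) * t i) (q_pow L (h i') * t i')"
    and lhs: "variant_lhs q L h t \<alpha> lam =
      q_equation.lhs q L \<alpha> lam (q_pow L (h i) * t i) (q_pow L (h i') * t i')"
    if "(i, i') \<in> {(1, 2), (2, 1)}" for i i'
  proof -
    have "t i \<noteq> 0" "t i' \<noteq> 0" "{i, i'} = {1, 2}"
      using that assms(4,5) by auto
    then show *: "q_equation q L (q_pow L (h i) * t i) (q_pow L (h i') * t i')"
      using assms(1-3) by unfold_locales auto
    show "variant_lhs q L h t \<alpha> lam =
      q_equation.lhs q L \<alpha> lam (q_pow L (h i) * t i) (q_pow L (h i') * t i')"
      by (rule variant_lhs_eq) (use * assms \<open>{i, i'} = {1, 2}\<close> in auto)
  qed
  interpret nonroot q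
    using assms(1,2) by unfold_locales
  have power_base: "q_pow L (- lam - \<alpha> + 1/2) = q_pow L (1/2) / (q_pow L lam * q_pow L \<alpha>)"
    unfolding q_pow_add q_pow_diff q_pow_minus by (simp add: field_simps)
  show ?thesis
  proof (intro conjI ballI)
    show "formal_solution q L (variant_lhs q L h t \<alpha> lam) (- \<alpha>) (\<lambda>n x. inverse x ^ n)
       (\<lambda>n x. (q_pow L (- lam - \<alpha> + 1/2) * inverse x) ^ n * q_poch (q_pow L (lam + \<alpha>)) q n
          * (\<Sum>l\<le>n. q powi (- int (l * (n - l)))
               * (q_pow L (h 1) * t 1) ^ (n - l) * (q_pow L (h 2) * t 2) ^ l
               / (q_poch q q (n - l) * q_poch q q l)))"
      \<comment> \<open>Here \<open>insertI1\<close> picks the pair (1, 2).\<close>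
      using q_equation.formal_solution_inverse_power[OF eqn[OF insertI1], of \<alpha> lam]
      unfolding lhs[OF insertI1] power_base q_pow_add[of L lam \<alpha>] rogers_szego_def .
  next
    fix p :: "nat \<times> nat"
    assume p: "p \<in> {(1, 2), (2, 1)}"
    obtain i i' where p_eq: "p = (i, i')" by (cases p)
    have "t i \<noteq> 0" "t i' \<noteq> 0"
      using p assms(4,5) by (auto simp: p_eq)
    then have shift: "q_pow L (h i + 1/2) * t i = q_pow L (1/2) * (q_pow L (h i) * t i)"
      "q_pow L (lam + \<alpha> + h i - h i') * t i / t i' =
         q_pow L lam * q_pow L \<alpha> * (q_pow L (h i) * t i) / (q_pow L (h i') * t i')"
      "\<And>x. x / (q_pow L (h i' - 1/2) * t i') = x * (q_pow L (1/2) / (q_pow L (h i') * t i'))"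
      unfolding q_pow_add q_pow_diff by simp_all
    note eqn = eqn[OF p[unfolded p_eq]] and lhs = lhs[OF p[unfolded p_eq]]
    show "case p of (i, i') \<Rightarrow>
          formal_solution q L (variant_lhs q L h t \<alpha> lam) (- \<alpha>)
            (\<lambda>n x. q_poch (q_pow L (h i + 1/2) * t i / x) q n)
            (\<lambda>n x. q_poch (q_pow L (h i + 1/2) * t i / x) q n
               * q_poch (q_pow L (lam + \<alpha>)) q n * q ^ n
               * (\<Sum>k\<le>n. q ^ (k\<^sup>2) * (q_pow L (lam + \<alpha> + h i - h i') * t i / t i') ^ k
                    / (q_poch q q k * q_poch q q (n - k))))"
      using q_equation.formal_solution_q_poch[OF eqn, of \<alpha> lam]
      unfolding p_eq prod.case lhs shift q_pow_add[of L lam \<alpha>] stieltjes_wigert_def .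
    show "case p of (i, i') \<Rightarrow>
          formal_solution q L (variant_lhs q L h t \<alpha> lam) lam
            (\<lambda>n x. q_poch (q_pow L (h i + 1/2) * t i / x) q n * x ^ n)
            (\<lambda>n x. q_poch (q_pow L (h i + 1/2) * t i / x) q n
               * (q_poch (q_pow L (lam + \<alpha>)) q n / q_poch q q n)
               * (x / (q_pow L (h i' - 1/2) * t i')) ^ n)
        \<and> (\<forall>n x. x \<noteq> 0 \<longrightarrow>
             q_poch (q_pow L (h i + 1/2) * t i / x) q n
               * (q_poch (q_pow L (lam + \<alpha>)) q n / q_poch q q n)
               * (x / (q_pow L (h i' - 1/2) * t i')) ^ n
             = q_hyper_term [q_pow L (lam + \<alpha>), q_pow L (h i + 1/2) * t i / x] [0] q
                 (x / (q_pow L (h i' - 1/2) * t i')) n)"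
      \<comment> \<open>The hypergeometric form is immediate: the exponent 1 + 1 - 2 of the sign and
        q-power factor is zero, and (0; q)_n = 1.\<close>
      using q_equation.formal_solution_q_poch_power[OF eqn, of \<alpha> lam]
      unfolding p_eq prod.case lhs shift q_pow_add[of L lam \<alpha>]
      by (simp add: q_hyper_term_def)
  qed
qed

end
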